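(* Let $\widehat{\tilde V}^{GS}$ be the Generalized Sandwich variance estimator built from an arbitrary bounding matrix $\tilde{\mathbf d}$, an arbitrary WLS weight matrix $\mathbf m$ and an arbitrary contrast vector $c$, and let $\widehat{\tilde V}^{OC0} := y'\mathbf R\,(\mathbf o_{(0)}/\mathbf p)\,\mathbf R y$ be the corresponding OC0 estimator, where $\mathbf o_{(0)} = \mathrm E[\mathbf O_{(0)}]$ and $\widehat{\tilde V}^{GS}=y'\mathbf O_{(0)}y$ (all objects as defined in the context). Then $\mathrm E\left[\mathbf R\,(\mathbf o_{(0)}/\mathbf p)\,\mathbf R\right]=\mathbf o_{(0)}$, and hence OC0 has the same expected value as the Generalized Sandwich: $$\mathrm E\left[\widehat{\tilde V}^{OC0}\right]=\mathrm E\left[\widehat{\tilde V}^{GS}\right].$$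
   Context: Setting. There are $n$ units and $k$ treatment arms. Potential outcomes are nonrandom and stacked as $y=(y_1'\ y_2'\cdots y_k')'\in\mathbb R^{kn}$, where $y_j\in\mathbb R^n$ is the vector of potential outcomes under arm $j$. The only random objects are the assignment indicators $R_{j\alpha}\in\{0,1\}$ ($j=1,\dots,k$ arms, $\alpha=1,\dots,n$ units), with $\sum_{j}R_{j\alpha}=1$ for every unit $\alpha$; their joint distribution (the experimental design) is arbitrary and known. $\mathbf R$ is the $kn\times kn$ diagonal matrix with diagonal $(R_{11},\dots,R_{1n},R_{21},\dots,R_{2n},\dots,R_{k1},\dots,R_{kn})$. $\boldsymbol\pi:=\mathrm E[\mathbf R]$, assumed to have strictly positive diagonal entries. With $1_m$ the length-$m$ vector of ones, $\mathbf p:=\mathrm E[\mathbf R 1_{kn}1_{kn}'\mathbf R]$ is the $kn\times kn$ matrix of (joint) assignment probabilities. Covariates: $\mathbf x$ is a nonrandom $n\times l$ matrix ($l\ge 0$), and $\mathbb x$ is the $kn\times(k+l)$ matrix whose $j$-th block of $n$ rows is $[\,0\cdots 0\ 1_n\ 0\cdots 0\ \ \mathbf x\,]$, with $1_n$ in column $j$. WLS: $\mathbf m$ is a nonrandom $kn\times kn$ diagonal matrix with nonnegative diagonal entries (some strictly positive); $\mathbf W:=(\mathbb x'\mathbf m\mathbf R\mathbb x)^{-1}\mathbb x'\mathbf m$, where $\mathbb x'\mathbf m\mathbf R\mathbb x$ is assumed invertible for every assignment of positive probability. The contrast vector $c\in\mathbb R^{k+l}$ is nonrandom, with its first $k$ entries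 the contrast values and its last $l$ entries zero. Bounding matrix: the design matrix is the $kn\times kn$ covariance matrix $\mathbf d:=\mathrm V(1_{kn}'\boldsymbol\pi^{-1}\mathbf R)$. A $kn\times kn$ matrix $\tilde{\mathbf d}$ is a bounding matrix if $v'\mathbf d v\le v'\tilde{\mathbf d}v$ for all $v\in\mathbb R^{kn}$. For matrices $A,B$ of equal size, $A/B$ denotes element-wise division, with division by zero defined to equal zero. For a vector $v$, $\mathrm{diag}(v)$ is the diagonal matrix with diagonal $v$. Generalized Sandwich: let $U:=y-\mathbb x\mathbf W\mathbf R y$, $Z_c:=\boldsymbol\pi\,\mathrm{diag}(U)\mathbf W'c$, and $$\widehat{\tilde V}^{GS}:=Z_c'\,\mathbf R(\tilde{\mathbf d}/\mathbf p)\mathbf R\,Z_c .$$ With the residual-maker matrix $\mathbf M:=\mathbf R-\mathbf R\mathbb x\mathbf W\mathbf R$ (so $\mathbf R U=\mathbf M y$), one has $\widehat{\tilde V}^{GS}=y'\mathbf O_{(0)}y$ where $$\mathbf O_{(0)}:=\mathbf M'\,\mathrm{diag}(c'\mathbf W)\,\big(\boldsymbol\pi(\tilde{\mathbf d}/\mathbf p)\boldsymbol\pi\big)\,\mathrm{diag}(c'\mathbf W)\,\mathbf M .$$ *)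

theory Defs
  imports
    "HOL-Probability.Probability"
    "Jordan_Normal_Form.Gauss_Jordan_Elimination"
begin

hide_const (open) Finite_Cartesian_Product.vec Finite_Cartesian_Product.mat
unbundle no inner_syntax
unbundle no vec_syntax

text \<open>
  Dimensions are natural numbers and all indices start at \<open>0\<close>: entry \<open>i < k * n\<close> of a stacked
  vector belongs to arm \<open>i div n\<close> and unit \<open>i mod n\<close>. An assignment is a function
  \<open>r\<close> with \<open>r j a\<close> the indicator that unit \<open>a\<close> is in arm \<open>j\<close>.
\<close>

definition assign_mat :: "nat \<Rightarrow> nat \<Rightarrow> (nat \<Rightarrow> nat \<Rightarrow> real) \<Rightarrow> real mat" where
  "assign_mat k n r = mat_diag (k * n) (\<lambda>i. r (i div n) (i mod n))"

definition stacked_covariates :: "nat \<Rightarrow> nat \<Rightarrow> nat \<Rightarrow> real mat \<Rightarrow> real mat" where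
  "stacked_covariates k n l x = mat (k * n) (k + l)
     (\<lambda>(i, j). if j < k then (if i div n = j then 1 else 0) else x $$ (i mod n, j - k))"

definition ones_mat :: "nat \<Rightarrow> nat \<Rightarrow> real mat" where
  "ones_mat nr nc = mat nr nc (\<lambda>_. 1)"

definition diag_of :: "real vec \<Rightarrow> real mat" where
  "diag_of v = mat_diag (dim_vec v) (\<lambda>i. v $ i)"

text \<open>Division by zero is zero in HOL, as required of the element-wise quotient.\<close>

definition elem_div :: "real mat \<Rightarrow> real mat \<Rightarrow> real mat" where
  "elem_div A B = mat (dim_row A) (dim_col A) (\<lambda>(i, j). A $$ (i, j) / B $$ (i, j))"

text \<open>The inverse is unspecified for a singular argument.\<close>

definition inv_mat :: "real mat \<Rightarrow> real mat" where
  "inv_mat A = the (mat_inverse A)"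

definition expect_mat :: "'w measure \<Rightarrow> nat \<Rightarrow> nat \<Rightarrow> ('w \<Rightarrow> real mat) \<Rightarrow> real mat" where
  "expect_mat P nr nc F = mat nr nc (\<lambda>(i, j). \<integral>\<omega>. F \<omega> $$ (i, j) \<partial>P)"

text \<open>Covariance matrix of a random row vector, given as a \<open>1 \<times> N\<close> matrix.\<close>

definition covariance_mat :: "'w measure \<Rightarrow> nat \<Rightarrow> ('w \<Rightarrow> real mat) \<Rightarrow> real mat" where
  "covariance_mat P N F = mat N N (\<lambda>(i, j).
     \<integral>\<omega>. (F \<omega> $$ (0, i) - (\<integral>\<omega>'. F \<omega>' $$ (0, i) \<partial>P)) *
         (F \<omega> $$ (0, j) - (\<integral>\<omega>'. F \<omega>' $$ (0, j) \<partial>P)) \<partial>P)"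

definition assign_prob_mat :: "'w measure \<Rightarrow> nat \<Rightarrow> ('w \<Rightarrow> real mat) \<Rightarrow> real mat" where
  "assign_prob_mat P N R = expect_mat P N N R"

definition joint_prob_mat :: "'w measure \<Rightarrow> nat \<Rightarrow> ('w \<Rightarrow> real mat) \<Rightarrow> real mat" where
  "joint_prob_mat P N R = expect_mat P N N (\<lambda>\<omega>. R \<omega> * ones_mat N 1 * (ones_mat N 1)\<^sup>T * R \<omega>)"

definition design_mat :: "'w measure \<Rightarrow> nat \<Rightarrow> ('w \<Rightarrow> real mat) \<Rightarrow> real mat" where
  "design_mat P N R =
     covariance_mat P N (\<lambda>\<omega>. (ones_mat N 1)\<^sup>T * inv_mat (assign_prob_mat P N R) * R \<omega>)"

definition bounding_mat :: "nat \<Rightarrow> real mat \<Rightarrow> real mat \<Rightarrow> bool" where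
  "bounding_mat N d dt \<longleftrightarrow> dt \<in> carrier_mat N N \<and>
     (\<forall>v \<in> carrier_vec N. v \<bullet> (d *\<^sub>v v) \<le> v \<bullet> (dt *\<^sub>v v))"

text \<open>
  Below, \<open>X\<close> is the stacked covariate matrix, \<open>m\<close> the weight matrix, \<open>Q\<close> the matrix
  \<open>assign_prob_mat\<close>, \<open>p\<close> the matrix \<open>joint_prob_mat\<close>, \<open>dt\<close> the bounding matrix and \<open>R\<close> a
  realised assignment matrix.
\<close>

definition wls_mat :: "real mat \<Rightarrow> real mat \<Rightarrow> real mat \<Rightarrow> real mat" where
  "wls_mat X m R = inv_mat (X\<^sup>T * m * R * X) * (X\<^sup>T * m)"

definition resid_vec :: "real mat \<Rightarrow> real mat \<Rightarrow> real vec \<Rightarrow> real mat \<Rightarrow> real vec" where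
  "resid_vec X m y R = y - X *\<^sub>v (wls_mat X m R *\<^sub>v (R *\<^sub>v y))"

definition sandwich_vec ::
  "real mat \<Rightarrow> real mat \<Rightarrow> real mat \<Rightarrow> real vec \<Rightarrow> real vec \<Rightarrow> real mat \<Rightarrow> real vec" where
  "sandwich_vec Q X m c y R = Q *\<^sub>v (diag_of (resid_vec X m y R) *\<^sub>v ((wls_mat X m R)\<^sup>T *\<^sub>v c))"

definition V_GS ::
  "real mat \<Rightarrow> real mat \<Rightarrow> real mat \<Rightarrow> real mat \<Rightarrow> real mat \<Rightarrow> real vec \<Rightarrow> real vec \<Rightarrow> real mat \<Rightarrow> real"
where
  "V_GS Q p dt X m c y R =
     sandwich_vec Q X m c y R \<bullet> ((R * elem_div dt p * R) *\<^sub>v sandwich_vec Q X m c y R)"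

definition resid_maker :: "real mat \<Rightarrow> real mat \<Rightarrow> real mat \<Rightarrow> real mat" where
  "resid_maker X m R = R - R * X * wls_mat X m R * R"

definition O0_mat ::
  "real mat \<Rightarrow> real mat \<Rightarrow> real mat \<Rightarrow> real mat \<Rightarrow> real mat \<Rightarrow> real vec \<Rightarrow> real mat \<Rightarrow> real mat"
where
  "O0_mat Q p dt X m c R =
     (resid_maker X m R)\<^sup>T * diag_of ((wls_mat X m R)\<^sup>T *\<^sub>v c)
       * (Q * elem_div dt p * Q)
       * diag_of ((wls_mat X m R)\<^sup>T *\<^sub>v c) * resid_maker X m R"

definition V_OC0 :: "real mat \<Rightarrow> real mat \<Rightarrow> real vec \<Rightarrow> real mat \<Rightarrow> real" where
  "V_OC0 p o0 y R = y \<bullet> ((R * elem_div o0 p * R) *\<^sub>v y)"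

end

theory Submission
  imports Defs
begin

text \<open>
  Entry \<open>(i, j)\<close> of \<open>E[R (o\<^sub>0 / p) R]\<close> is \<open>p\<^sub>i\<^sub>j (o\<^sub>0\<^sub>,\<^sub>i\<^sub>j / p\<^sub>i\<^sub>j)\<close>, so only the entries with
  \<open>p\<^sub>i\<^sub>j = 0\<close> need an argument. There \<open>R\<^sub>i R\<^sub>j = 0\<close> almost surely, and since the residual maker has
  \<open>R\<close> as a right factor, \<open>O\<^sub>0\<close> has the factor \<open>R\<^sub>i R\<^sub>j\<close> in its \<open>(i, j)\<close> entry; hence
  \<open>o\<^sub>0\<close> vanishes there as well. Equality of the expectations follows by linearity, using
  \<open>V\<^sup>G\<^sup>S = y' O\<^sub>0 y\<close> for every assignment of positive probability.
\<close>

section \<open>Diagonal matrices and expectations of quadratic forms\<close>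

lemma mat_diag_mult_vec:
  assumes "v \<in> carrier_vec N"
  shows "mat_diag N f *\<^sub>v v = vec N (\<lambda>i. f i * v $ i)"
proof (rule eq_vecI)
  fix i assume "i < dim_vec (vec N (\<lambda>i. f i * v $ i))"
  then have i: "i < N" by simp
  have "(mat_diag N f *\<^sub>v v) $ i = (\<Sum>t\<in>{0..<N}. (if i = t then f t else 0) * v $ t)"
    using i assms by (auto simp: scalar_prod_def mat_diag_def intro!: sum.cong)
  also have "\<dots> = (\<Sum>t\<in>{0..<N}. if i = t then f t * v $ t else 0)"
    by (rule sum.cong) auto
  also have "\<dots> = f i * v $ i" using i by simp
  finally show "(mat_diag N f *\<^sub>v v) $ i = vec N (\<lambda>i. f i * v $ i) $ i"
    using i by simp
qed (simp add: mat_diag_def)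

lemma mat_diag_adjoint:
  fixes u v :: "real vec"
  assumes "u \<in> carrier_vec N" "v \<in> carrier_vec N"
  shows "u \<bullet> (mat_diag N f *\<^sub>v v) = (mat_diag N f *\<^sub>v u) \<bullet> v"
  using assms by (auto simp: mat_diag_mult_vec scalar_prod_def intro!: sum.cong)

lemma mat_diag_sandwich:
  fixes A :: "real mat"
  assumes "A \<in> carrier_mat N N"
  shows "mat_diag N f * A * mat_diag N f = mat N N (\<lambda>(i, j). f i * f j * A $$ (i, j))"
  using assms
  by (auto simp: mat_diag_mult_left mat_diag_mult_right[of _ N] intro!: eq_matI)

text \<open>Used to move the outer factor \<open>M\<^sup>T\<close> of \<open>O0_mat\<close> across
  the inner product, where it meets \<open>y\<close> as \<open>M *\<^sub>v y\<close>.\<close>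

lemma adjoint_mult_mat_vec:
  fixes A :: "real mat"
  assumes "A \<in> carrier_mat nr nc" "u \<in> carrier_vec nc" "v \<in> carrier_vec nr"
  shows "u \<bullet> (A\<^sup>T *\<^sub>v v) = (A *\<^sub>v u) \<bullet> v"
  using transpose_vec_mult_scalar[OF assms] assms
  by (metis comm_scalar_prod mult_mat_vec_carrier transpose_carrier_mat)

lemma quadratic_form_sum:
  fixes A :: "real mat"
  assumes "A \<in> carrier_mat N N" "y \<in> carrier_vec N"
  shows "y \<bullet> (A *\<^sub>v y) = (\<Sum>i<N. \<Sum>j<N. y $ i * y $ j * A $$ (i, j))"
proof -
  have "y \<bullet> (A *\<^sub>v y) = (\<Sum>i<N. y $ i * (\<Sum>j<N. A $$ (i, j) * y $ j))"
    using assms by (auto simp: scalar_prod_def atLeast0LessThan intro!: sum.cong)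
  then show ?thesis by (simp add: sum_distrib_left mult_ac)
qed

lemma integral_quadratic_form:
  fixes F :: "'w \<Rightarrow> real mat"
  assumes "\<And>\<omega>. \<omega> \<in> space P \<Longrightarrow> F \<omega> \<in> carrier_mat N N" and "y \<in> carrier_vec N"
    and int: "\<And>i j. i < N \<Longrightarrow> j < N \<Longrightarrow> integrable P (\<lambda>\<omega>. F \<omega> $$ (i, j))"
  shows "(\<integral>\<omega>. y \<bullet> (F \<omega> *\<^sub>v y) \<partial>P) = y \<bullet> (expect_mat P N N F *\<^sub>v y)"
proof -
  have "(\<integral>\<omega>. y \<bullet> (F \<omega> *\<^sub>v y) \<partial>P)
      = (\<integral>\<omega>. (\<Sum>i<N. \<Sum>j<N. y $ i * y $ j * F \<omega> $$ (i, j)) \<partial>P)"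
    by (rule Bochner_Integration.integral_cong) (use assms in \<open>auto simp: quadratic_form_sum\<close>)
  also have "\<dots> = (\<Sum>i<N. \<Sum>j<N. y $ i * y $ j * (\<integral>\<omega>. F \<omega> $$ (i, j) \<partial>P))"
    \<comment> \<open>The substitution is repeated because the sum is double: one exchange with the
      integral per index.\<close>
    using int by (subst Bochner_Integration.integral_sum, force)+ simp
  also have "\<dots> = y \<bullet> (expect_mat P N N F *\<^sub>v y)"
    using assms(2) by (subst quadratic_form_sum) (auto simp: expect_mat_def)
  finally show ?thesis .
qed

section \<open>Random variables with finitely many values\<close>

text \<open>Since \<open>f\<close> has finitely many values, \<open>g (f \<omega>)\<close> is again
  simple and therefore bounded and measurable, for completely arbitrary \<open>g\<close>. This
  settles integrability of expressions that contain a matrix inverse without studying how the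
  inverse depends on its argument.\<close>

lemma (in finite_measure) integrable_simple_compose:
  fixes g :: "'b \<Rightarrow> real"
  assumes "simple_function M f"
  shows "integrable M (\<lambda>\<omega>. g (f \<omega>))"
proof -
  have sf: "simple_function M (\<lambda>\<omega>. g (f \<omega>))"
    using simple_function_compose[OF assms, of g] by (simp add: comp_def)
  then have fin: "finite ((\<lambda>\<omega>. \<bar>g (f \<omega>)\<bar>) ` space M)"
    using simple_functionD(1)[OF simple_function_compose[OF sf, of abs]] by (simp add: comp_def)
  \<comment> \<open>The finite range supplies the bound: its largest absolute value.\<close>
  show ?thesis
    by (rule integrable_const_bound[where B = "Max ((\<lambda>\<omega>. \<bar>g (f \<omega>)\<bar>) ` space M)"])
      (use fin sf in \<open>auto intro!: AE_I2 Max_ge borel_measurable_simple_function\<close>)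
qed

text \<open>The null fibres are finitely many, so their union is null. This turns a property known
  for each assignment of positive probability into one that holds almost everywhere.\<close>

lemma (in finite_measure) AE_simple_function_fibre_pos:
  assumes "simple_function M f"
  shows "AE \<omega> in M. measure M {\<omega>' \<in> space M. f \<omega>' = f \<omega>} > 0"
proof -
  \<comment> \<open>Quantifying over values rather than points leaves a finite conjunction, so each
    fibre can be treated on its own.\<close>
  have "AE \<omega> in M. \<forall>v\<in>f ` space M. measure M {\<omega>' \<in> space M. f \<omega>' = v} = 0 \<longrightarrow> f \<omega> \<noteq> v"
  proof (rule AE_finite_allI)
    show "finite (f ` space M)" using assms by (rule simple_functionD)
    fix v
    have "f -` {v} \<inter> space M \<in> sets M" using assms by (rule simple_functionD)
    moreover have "f -` {v} \<inter> space M = {\<omega>' \<in> space M. f \<omega>' = v}" by auto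
    ultimately have "{\<omega>' \<in> space M. f \<omega>' = v} \<in> sets M" by simp
    then show "AE \<omega> in M. measure M {\<omega>' \<in> space M. f \<omega>' = v} = 0 \<longrightarrow> f \<omega> \<noteq> v"
      by (cases "measure M {\<omega>' \<in> space M. f \<omega>' = v} = 0")
        (auto intro!: AE_I[where N = "{\<omega>' \<in> space M. f \<omega>' = v}"] simp: emeasure_eq_measure)
  qed
  then show ?thesis
    by (rule AE_mp) (auto intro!: AE_I2 simp: zero_less_measure_iff)
qed

section \<open>The assignment matrix as a simple random variable\<close>

text \<open>Arm \<open>j\<close> and unit \<open>a\<close> are read off at diagonal position
  \<open>j * n + a\<close>, and division with remainder by \<open>n\<close> recovers them. This
  identifies fibres of the random matrix with events about the indicators, the form in which
  invertibility is assumed.\<close>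

lemma assign_mat_eq_iff:
  "assign_mat k n r = assign_mat k n s \<longleftrightarrow> (\<forall>j<k. \<forall>a<n. r j a = s j a)"
proof
  assume eq: "assign_mat k n r = assign_mat k n s"
  show "\<forall>j<k. \<forall>a<n. r j a = s j a"
  proof (intro allI impI)
    fix j a assume ja: "j < k" "a < n"
    have "j * n + a < Suc j * n" using ja by simp
    also have "\<dots> \<le> k * n" using ja by (intro mult_right_mono) auto
    finally have "j * n + a < k * n" .
    moreover have "assign_mat k n r $$ (j * n + a, j * n + a)
        = assign_mat k n s $$ (j * n + a, j * n + a)" using eq by simp
    ultimately show "r j a = s j a" using ja by (simp add: assign_mat_def mat_diag_def)
  qed
next
  assume "\<forall>j<k. \<forall>a<n. r j a = s j a"
  \<comment> \<open>For \<open>n = 0\<close> there is no index below \<open>k * n\<close>, which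
    disposes of division by zero.\<close>
  moreover have "i div n < k \<and> i mod n < n" if "i < k * n" for i
    using that by (cases "n = 0") (auto simp: less_mult_imp_div_less)
  ultimately show "assign_mat k n r = assign_mat k n s"
    by (auto simp: assign_mat_def mat_diag_def intro!: eq_matI)
qed

text \<open>The diagonal is a 0-1 word of length \<open>k * n\<close>, hence finitely many values;
  each fibre is a finite intersection of events on which one indicator has a prescribed
  value.\<close>

lemma simple_function_assign_mat:
  assumes meas: "\<And>j a. j < k \<Longrightarrow> a < n \<Longrightarrow> ind j a \<in> borel_measurable P"
    and bin: "\<And>j a \<omega>. j < k \<Longrightarrow> a < n \<Longrightarrow> \<omega> \<in> space P \<Longrightarrow> ind j a \<omega> \<in> {0, 1}"
  shows "simple_function P (\<lambda>\<omega>. assign_mat k n (\<lambda>j a. ind j a \<omega>))" (is "simple_function P ?R")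
  unfolding simple_function_def
proof
  have dm: "i div n < k" "i mod n < n" if "i < k * n" for i
    using that by (cases "n = 0"; auto simp: less_mult_imp_div_less)+
  \<comment> \<open>Extensional functions are used because they form a finite set; restricting the
    diagonal to indices below \<open>k * n\<close> leaves the matrix unchanged.\<close>
  let ?S = "mat_diag (k * n) ` ({..<k * n} \<rightarrow>\<^sub>E {0, 1::real})"
  have "?R \<omega> \<in> ?S" if "\<omega> \<in> space P" for \<omega>
  proof (rule image_eqI)
    show "?R \<omega> = mat_diag (k * n) (restrict (\<lambda>i. ind (i div n) (i mod n) \<omega>) {..<k * n})"
      by (auto simp: assign_mat_def mat_diag_def intro!: eq_matI)
    show "restrict (\<lambda>i. ind (i div n) (i mod n) \<omega>) {..<k * n} \<in> {..<k * n} \<rightarrow>\<^sub>E {0, 1}"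
      using bin[OF dm that] by auto
  qed
  then have "?R ` space P \<subseteq> ?S" by blast
  moreover have "finite ?S" by (intro finite_imageI finite_PiE) auto
  ultimately show "finite (?R ` space P)" by (rule finite_subset)
  show "\<forall>v\<in>?R ` space P. ?R -` {v} \<inter> space P \<in> sets P"
  proof
    fix v assume "v \<in> ?R ` space P"
    then obtain \<omega> where v: "v = ?R \<omega>" by blast
    have "?R -` {v} \<inter> space P
        = {\<omega>' \<in> space P. \<forall>j\<in>{..<k}. \<forall>a\<in>{..<n}. ind j a \<omega>' = ind j a \<omega>}"
      unfolding v vimage_def by (auto simp: assign_mat_eq_iff)
    moreover have "\<dots> \<in> sets P"
      using meas by (intro sets.sets_Collect_finite_All measurable_sets_borel)
       (auto intro!: borel_measurable_eq)
    ultimately show "?R -` {v} \<inter> space P \<in> sets P" by simp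
  qed
qed

section \<open>Dimensions of the inverse and the zero entries of \<open>O0_mat\<close>\<close>

text \<open>An inverse makes the matrix a unit of the matrix ring, so \<open>mat_inverse\<close>
  cannot return \<open>None\<close>; any result it does return has the right dimensions.\<close>

lemma inv_mat_carrier:
  assumes A: "A \<in> carrier_mat K K" and inv: "invertible_mat A"
  shows "inv_mat A \<in> carrier_mat K K"
proof (cases "mat_inverse A")
  case None
  obtain B where B: "A * B = 1\<^sub>m (dim_row A)" "B * A = 1\<^sub>m (dim_row B)"
    using inv by (auto simp: invertible_mat_def inverts_mat_def)
  \<comment> \<open>\<open>invertible_mat\<close> leaves the dimensions of the witness open;
    comparing column counts in the two identities determines them.\<close>
  have "dim_col B = K" using arg_cong[OF B(1), of dim_col] A by simp
  moreover have "dim_row B = K" using arg_cong[OF B(2), of dim_col] A by simp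
  ultimately have "B \<in> carrier_mat K K" by auto
  then have "A \<in> Units (ring_mat TYPE(real) K ())"
    using A B by (auto simp: Units_def ring_mat_def)
  with mat_inverse(1)[OF A None, where b = "()"] show ?thesis by blast
next
  case (Some B)
  with mat_inverse(2)[OF A Some] show ?thesis by (simp add: inv_mat_def)
qed

lemma resid_maker_carrier:
  assumes "R \<in> carrier_mat N N"
  shows "resid_maker X m R \<in> carrier_mat N N"
  using assms by (auto simp: resid_maker_def)

text \<open>
  Nothing is assumed about \<open>wls_mat\<close>, which may be junk of the wrong dimension on a null set of
  assignments.
\<close>

lemma resid_maker_col_zero:
  assumes "i < N" "t < N" "f i = 0"
  shows "resid_maker X m (mat_diag N f) $$ (t, i) = 0"
  using assms
  by (auto simp: resid_maker_def times_mat_def scalar_prod_def mat_diag_def intro!: sum.neutral)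

lemma O0_mat_carrier:
  assumes "R \<in> carrier_mat N N"
  shows "O0_mat Q p dt X m c R \<in> carrier_mat N N"
  using resid_maker_carrier[OF assms, of X m] by (auto simp: O0_mat_def)

lemma O0_mat_zero:
  assumes "m \<in> carrier_mat N N" "Q \<in> carrier_mat N N" "i < N" "j < N" "f i * f j = 0"
  shows "O0_mat Q p dt X m c (mat_diag N f) $$ (i, j) = 0"
proof -
  define M where "M = resid_maker X m (mat_diag N f)"
  define D where "D = diag_of ((wls_mat X m (mat_diag N f))\<^sup>T *\<^sub>v c)"
  define S where "S = Q * elem_div dt p * Q"
  have M: "M \<in> carrier_mat N N" unfolding M_def by (rule resid_maker_carrier) simp
  \<comment> \<open>The order of \<open>D\<close> is the number of columns of
    \<open>wls_mat\<close>, which is that of \<open>m\<close> whatever the inverse is. Hence this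
    also covers a singular argument.\<close>
  have D: "D \<in> carrier_mat N N"
    using assms(1) by (auto simp: D_def diag_of_def wls_mat_def)
  have S: "S \<in> carrier_mat N N" using assms(2) by (auto simp: S_def)
  have O: "O0_mat Q p dt X m c (mat_diag N f) = M\<^sup>T * D * S * D * M"
    by (simp add: O0_mat_def M_def D_def S_def)
  consider "f i = 0" | "f j = 0" using assms(5) by auto
  then show ?thesis
  proof cases
    case 1
    then have "M $$ (t, i) = 0" if "t < N" for t
      unfolding M_def using assms(3) that by (intro resid_maker_col_zero)
    \<comment> \<open>Grouped to the right, entry (i, j) is a sum with factors
      \<open>M $$ (t, i)\<close>, all zero. In the other case the given grouping already shows the
      factors \<open>M $$ (t, j)\<close>.\<close>
    moreover have "M\<^sup>T * D * S * D * M = M\<^sup>T * (D * S * D * M)"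
      using M D S by (simp add: assoc_mult_mat[of _ N N _ N _ N])
    ultimately show ?thesis
      unfolding O using M D S assms by (auto simp: scalar_prod_def)
  next
    case 2
    then have "M $$ (t, j) = 0" if "t < N" for t
      unfolding M_def using assms(4) that by (intro resid_maker_col_zero)
    then show ?thesis
      unfolding O using M D assms by (auto simp: scalar_prod_def)
  qed
qed

section \<open>The Generalized Sandwich as a quadratic form in \<open>y\<close>\<close>

text \<open>Both sides reduce to the form of \<open>E\<close> at the vector
  \<open>R *\<^sub>v z\<close>. The bridge is M y = R U, together with the fact that
  \<open>R\<close>, \<open>Q\<close> and \<open>D\<close> are diagonal, hence symmetric and
  commuting.\<close>

lemma V_GS_eq_quadratic_form:
  fixes f q :: "nat \<Rightarrow> real"
  assumes idem: "\<And>i. i < N \<Longrightarrow> f i * f i = f i"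
    and X: "X \<in> carrier_mat N K" and W: "wls_mat X m (mat_diag N f) \<in> carrier_mat K N"
    and dt: "dt \<in> carrier_mat N N" and y: "y \<in> carrier_vec N"
  shows "V_GS (mat_diag N q) p dt X m c y (mat_diag N f)
       = y \<bullet> (O0_mat (mat_diag N q) p dt X m c (mat_diag N f) *\<^sub>v y)"
proof -
  define R where "R = mat_diag N f"
  define Q where "Q = mat_diag N q"
  define W' where "W' = wls_mat X m R"
  define w where "w = W'\<^sup>T *\<^sub>v c"
  define D where "D = mat_diag N (\<lambda>i. w $ i)"
  define E where "E = elem_div dt p"
  define U where "U = resid_vec X m y R"
  define M where "M = resid_maker X m R"
  define z where "z = Q *\<^sub>v (D *\<^sub>v U)"
  have R: "R \<in> carrier_mat N N" and Q: "Q \<in> carrier_mat N N" and D: "D \<in> carrier_mat N N"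
    by (auto simp: R_def Q_def D_def)
  have W': "W' \<in> carrier_mat K N" using W by (simp add: W'_def R_def)
  have w: "w \<in> carrier_vec N" using W' by (intro carrier_vecI) (simp add: w_def)
  have E: "E \<in> carrier_mat N N" using dt by (auto simp: E_def elem_div_def)
  have U_eq: "U = y - X *\<^sub>v (W' *\<^sub>v (R *\<^sub>v y))" by (simp add: U_def resid_vec_def W'_def)
  have Ry: "R *\<^sub>v y \<in> carrier_vec N" using R y by auto
  have XWRy: "X *\<^sub>v (W' *\<^sub>v (R *\<^sub>v y)) \<in> carrier_vec N" using X W' Ry by auto
  have U: "U \<in> carrier_vec N" unfolding U_eq using XWRy y by auto
  have M: "M \<in> carrier_mat N N" unfolding M_def by (rule resid_maker_carrier[OF R])
  have My: "M *\<^sub>v y = R *\<^sub>v U"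
  proof -
    have "M *\<^sub>v y = R *\<^sub>v y - (R * X * W' * R) *\<^sub>v y"
      unfolding M_def resid_maker_def W'_def[symmetric]
      by (rule minus_mult_distrib_mat_vec[OF R _ y]) (use R X W' in auto)
    also have "(R * X * W' * R) *\<^sub>v y = R *\<^sub>v (X *\<^sub>v (W' *\<^sub>v (R *\<^sub>v y)))"
      using R X W' y by (simp add: assoc_mult_mat_vec[of _ N N _ N] assoc_mult_mat_vec[of _ N K _ N]
        assoc_mult_mat_vec[of _ N N _ K])
    also have "R *\<^sub>v y - \<dots> = R *\<^sub>v U"
      unfolding U_eq using mult_minus_distrib_mat_vec[OF R y XWRy] by simp
    finally show ?thesis .
  qed
  have z: "z \<in> carrier_vec N" using Q D U by (auto simp: z_def)
  have Rz: "R *\<^sub>v z \<in> carrier_vec N" using R z by auto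
  \<comment> \<open>Commuting \<open>R\<close> past \<open>Q\<close> and \<open>D\<close> puts it
    next to \<open>U\<close>, where R U may be replaced by M y.\<close>
  have Rz_eq: "R *\<^sub>v z = Q *\<^sub>v (D *\<^sub>v (R *\<^sub>v U))"
    using U by (auto simp: z_def R_def Q_def D_def mat_diag_mult_vec)
  \<comment> \<open>Both sides are the entrywise product of \<open>U\<close> and \<open>w\<close>;
    the swap makes \<open>z\<close> the vector of the sandwich estimator.\<close>
  have DUw: "diag_of U *\<^sub>v w = D *\<^sub>v U"
    using U w by (auto simp: diag_of_def D_def mat_diag_mult_vec)
  have "V_GS Q p dt X m c y R = z \<bullet> ((R * E * R) *\<^sub>v z)"
    unfolding V_GS_def sandwich_vec_def
    by (simp only: U_def[symmetric] W'_def[symmetric] w_def[symmetric] DUw z_def[symmetric]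
        E_def[symmetric])
  also have "(R * E * R) *\<^sub>v z = R *\<^sub>v (E *\<^sub>v (R *\<^sub>v z))"
    using R E z by (simp add: assoc_mult_mat_vec[of _ N N _ N])
  also have "z \<bullet> \<dots> = (R *\<^sub>v z) \<bullet> (E *\<^sub>v (R *\<^sub>v z))"
    unfolding R_def by (rule mat_diag_adjoint) (use z E Rz R_def in auto)
  finally have lhs: "V_GS Q p dt X m c y R = (R *\<^sub>v z) \<bullet> (E *\<^sub>v (R *\<^sub>v z))" .
  have diag_w: "diag_of w = D" using w by (simp add: diag_of_def D_def)
  have "O0_mat Q p dt X m c R *\<^sub>v y = (M\<^sup>T * D * (Q * E * Q) * D * M) *\<^sub>v y"
    unfolding O0_mat_def by (simp only: M_def[symmetric] W'_def[symmetric] w_def[symmetric]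
        E_def[symmetric] diag_w)
  also have "\<dots> = M\<^sup>T *\<^sub>v (D *\<^sub>v (Q *\<^sub>v (E *\<^sub>v (Q *\<^sub>v (D *\<^sub>v (M *\<^sub>v y))))))"
    using M D Q E y
    by (simp add: assoc_mult_mat_vec[of _ N N _ N] mult_carrier_mat[of _ N N _ N]
        mult_mat_vec_carrier[of _ N N] del: assoc_mult_mat)
  also have "\<dots> = M\<^sup>T *\<^sub>v (D *\<^sub>v (Q *\<^sub>v (E *\<^sub>v (R *\<^sub>v z))))"
    by (simp add: My Rz_eq)
  finally have O: "O0_mat Q p dt X m c R *\<^sub>v y = \<dots>" .
  have Ez: "E *\<^sub>v (R *\<^sub>v z) \<in> carrier_vec N" using E Rz by auto
  have "y \<bullet> (M\<^sup>T *\<^sub>v (D *\<^sub>v (Q *\<^sub>v (E *\<^sub>v (R *\<^sub>v z)))))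
      = (R *\<^sub>v U) \<bullet> (D *\<^sub>v (Q *\<^sub>v (E *\<^sub>v (R *\<^sub>v z))))"
    by (subst adjoint_mult_mat_vec[OF M y]) (use My D Q Ez in auto)
  also have "\<dots> = (D *\<^sub>v (R *\<^sub>v U)) \<bullet> (Q *\<^sub>v (E *\<^sub>v (R *\<^sub>v z)))"
    unfolding D_def by (rule mat_diag_adjoint) (use R U Q Ez in auto)
  also have "\<dots> = (R *\<^sub>v z) \<bullet> (E *\<^sub>v (R *\<^sub>v z))"
    unfolding Rz_eq unfolding Q_def
    by (rule mat_diag_adjoint) (use R U D Ez Rz_eq Q_def in auto)
  finally show ?thesis using lhs O by (simp add: R_def Q_def)
qed

section \<open>Unbiasedness of the reweighted matrix and equality of the expectations\<close>

theorem mainTheorem1: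
  fixes P :: "'w measure"
    and n k l :: nat
    and ind :: "nat \<Rightarrow> nat \<Rightarrow> 'w \<Rightarrow> real"
    and y c :: "real vec"
    and x m dt :: "real mat"
  defines "N \<equiv> k * n"
  defines "R \<equiv> \<lambda>\<omega>. assign_mat k n (\<lambda>j a. ind j a \<omega>)"
  defines "X \<equiv> stacked_covariates k n l x"
  defines "Q \<equiv> assign_prob_mat P N R"
  defines "p \<equiv> joint_prob_mat P N R"
  defines "o0 \<equiv> expect_mat P N N (\<lambda>\<omega>. O0_mat Q p dt X m c (R \<omega>))"
  assumes "prob_space P"
    and "\<And>j a. j < k \<Longrightarrow> a < n \<Longrightarrow> ind j a \<in> borel_measurable P"
    and "\<And>j a \<omega>. j < k \<Longrightarrow> a < n \<Longrightarrow> \<omega> \<in> space P \<Longrightarrow> ind j a \<omega> \<in> {0, 1}"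
    and "\<And>a \<omega>. a < n \<Longrightarrow> \<omega> \<in> space P \<Longrightarrow> (\<Sum>j<k. ind j a \<omega>) = 1"
    and "\<And>i. i < N \<Longrightarrow> Q $$ (i, i) > 0"
    and "y \<in> carrier_vec N"
    and "x \<in> carrier_mat n l"
    and "m \<in> carrier_mat N N" and "diagonal_mat m"
    and "\<And>i. i < N \<Longrightarrow> m $$ (i, i) \<ge> 0"
    and "\<exists>i<N. m $$ (i, i) > 0"
    and "\<And>r. measure P {\<omega> \<in> space P. \<forall>j<k. \<forall>a<n. ind j a \<omega> = r j a} > 0
           \<Longrightarrow> invertible_mat (X\<^sup>T * m * assign_mat k n r * X)"
    and "c \<in> carrier_vec (k + l)"
    and "\<And>i. k \<le> i \<Longrightarrow> i < k + l \<Longrightarrow> c $ i = 0"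
    and "bounding_mat N (design_mat P N R) dt"
  shows "expect_mat P N N (\<lambda>\<omega>. R \<omega> * elem_div o0 p * R \<omega>) = o0
    \<and> (\<integral>\<omega>. V_OC0 p o0 y (R \<omega>) \<partial>P) = (\<integral>\<omega>. V_GS Q p dt X m c y (R \<omega>) \<partial>P)"
proof -
  interpret prob_space P by fact
  note meas = assms(8) and bin = assms(9) and y = assms(12) and m = assms(14)
    and inv = assms(18)
  define K where "K = k + l"
  define r where "r = (\<lambda>\<omega> i. ind (i div n) (i mod n) \<omega>)"
  have R_eq: "R \<omega> = mat_diag N (r \<omega>)" for \<omega>
    by (simp add: R_def assign_mat_def r_def N_def)
  have R: "R \<omega> \<in> carrier_mat N N" for \<omega> by (simp add: R_eq)
  have idx: "i div n < k" "i mod n < n" if "i < N" for i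
    using that unfolding N_def by (cases "n = 0"; auto simp: less_mult_imp_div_less)+
  have r01: "r \<omega> i \<in> {0, 1}" if "i < N" "\<omega> \<in> space P" for \<omega> i
    unfolding r_def using idx that by (intro bin)
  have sf: "simple_function P R"
    unfolding R_def by (rule simple_function_assign_mat) (use meas bin in auto)
  have X: "X \<in> carrier_mat N K" by (simp add: X_def stacked_covariates_def N_def K_def)
  have dt: "dt \<in> carrier_mat N N" using assms(21) by (simp add: bounding_mat_def)
  define q where "q = (\<lambda>i. \<integral>\<omega>. r \<omega> i \<partial>P)"
  have Q_eq: "Q = mat_diag N q"
    unfolding Q_def assign_prob_mat_def expect_mat_def
    by (rule eq_matI) (auto simp: R_eq q_def mat_diag_def)
  have p_eq: "p $$ (i, j) = (\<integral>\<omega>. r \<omega> i * r \<omega> j \<partial>P)" if "i < N" "j < N" for i j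
  proof -
    have "R \<omega> * ones_mat N 1 * (ones_mat N 1)\<^sup>T * R \<omega>
        = mat N N (\<lambda>(i, j). r \<omega> i * r \<omega> j)" for \<omega>
    proof -
      have ones: "ones_mat N 1 \<in> carrier_mat N 1" by (simp add: ones_mat_def)
      have "R \<omega> * ones_mat N 1 * (ones_mat N 1)\<^sup>T
          = R \<omega> * (ones_mat N 1 * (ones_mat N 1)\<^sup>T)"
        by (rule assoc_mult_mat[OF R ones]) (use ones in auto)
      moreover have "ones_mat N 1 * (ones_mat N 1)\<^sup>T = mat N N (\<lambda>_. 1)"
        by (rule eq_matI) (auto simp: ones_mat_def scalar_prod_def)
      ultimately show ?thesis unfolding R_eq by (auto simp: mat_diag_sandwich)
    qed
    then show ?thesis using that by (simp add: p_def joint_prob_mat_def expect_mat_def)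
  qed
  define O0 where "O0 = O0_mat Q p dt X m c"
  have O0: "O0 (R \<omega>) \<in> carrier_mat N N" for \<omega>
    unfolding O0_def by (rule O0_mat_carrier[OF R])
  have o0_eq: "o0 = expect_mat P N N (\<lambda>\<omega>. O0 (R \<omega>))" by (simp add: o0_def O0_def)
  define T where "T = (\<lambda>\<omega>. R \<omega> * elem_div o0 p * R \<omega>)"
  have T_eq: "T \<omega> = mat N N (\<lambda>(i, j). r \<omega> i * r \<omega> j * (o0 $$ (i, j) / p $$ (i, j)))" for \<omega>
  proof -
    have "elem_div o0 p \<in> carrier_mat N N" by (simp add: elem_div_def o0_eq expect_mat_def)
    then show ?thesis unfolding T_def R_eq
      by (auto simp: mat_diag_sandwich elem_div_def o0_eq expect_mat_def intro!: eq_matI)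
  qed
  have o0_zero: "o0 $$ (i, j) = 0" if ij: "i < N" "j < N" and p0: "p $$ (i, j) = 0" for i j
  proof -
    \<comment> \<open>The product of indicators is written as a function of the matrix
      \<open>R \<omega>\<close>, so that the finite range of \<open>R\<close> gives
      integrability.\<close>
    have "integrable P (\<lambda>\<omega>. (\<lambda>A. A $$ (i, i) * A $$ (j, j)) (R \<omega>))"
      by (rule integrable_simple_compose[OF sf])
    then have "integrable P (\<lambda>\<omega>. r \<omega> i * r \<omega> j)"
      using ij by (simp add: R_eq mat_diag_def)
    moreover have "AE \<omega> in P. 0 \<le> r \<omega> i * r \<omega> j"
      using r01[OF ij(1)] r01[OF ij(2)] by (intro AE_I2) force
    \<comment> \<open>A nonnegative integrable function with integral \<open>p $$ (i, j) = 0\<close>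
      vanishes almost everywhere.\<close>
    ultimately have "AE \<omega> in P. r \<omega> i * r \<omega> j = 0"
      using integral_nonneg_eq_0_iff_AE p_eq[OF ij] p0 by metis
    then have "AE \<omega> in P. O0 (R \<omega>) $$ (i, j) = 0"
      unfolding O0_def R_eq by (rule AE_mp) (use m ij Q_eq in \<open>auto intro!: AE_I2 O0_mat_zero\<close>)
    then show ?thesis using ij by (simp add: o0_eq expect_mat_def integral_eq_zero_AE)
  qed
  have first: "expect_mat P N N T = o0"
  proof (rule eq_matI)
    fix i j assume "i < dim_row o0" "j < dim_col o0"
    then have ij: "i < N" "j < N" by (auto simp: o0_eq expect_mat_def)
    have "expect_mat P N N T $$ (i, j) = p $$ (i, j) * (o0 $$ (i, j) / p $$ (i, j))"
      using ij by (simp add: expect_mat_def T_eq p_eq)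
    \<comment> \<open>Where \<open>p $$ (i, j)\<close> is nonzero it cancels; where it is zero the
      left side is 0 and \<open>o0_zero\<close> says the same of the right.\<close>
    then show "expect_mat P N N T $$ (i, j) = o0 $$ (i, j)"
      using o0_zero[OF ij] by auto
  qed (auto simp: o0_eq expect_mat_def)
  have "(\<integral>\<omega>. V_OC0 p o0 y (R \<omega>) \<partial>P) = (\<integral>\<omega>. y \<bullet> (T \<omega> *\<^sub>v y) \<partial>P)"
    by (simp add: V_OC0_def T_def)
  also have "\<dots> = y \<bullet> (expect_mat P N N T *\<^sub>v y)"
  proof (rule integral_quadratic_form[OF _ y])
    fix i j
    show "integrable P (\<lambda>\<omega>. T \<omega> $$ (i, j))"
      unfolding T_def by (rule integrable_simple_compose[OF sf])
  qed (simp add: T_eq)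
  also have "\<dots> = y \<bullet> (expect_mat P N N (\<lambda>\<omega>. O0 (R \<omega>)) *\<^sub>v y)"
    by (simp only: first o0_eq)
  also have "\<dots> = (\<integral>\<omega>. y \<bullet> (O0 (R \<omega>) *\<^sub>v y) \<partial>P)"
  proof (rule integral_quadratic_form[OF _ y, symmetric])
    fix i j
    show "integrable P (\<lambda>\<omega>. O0 (R \<omega>) $$ (i, j))"
      by (rule integrable_simple_compose[OF sf])
  qed (rule O0)
  also have "\<dots> = (\<integral>\<omega>. V_GS Q p dt X m c y (R \<omega>) \<partial>P)"
  proof (rule integral_cong_AE)
    show "(\<lambda>\<omega>. y \<bullet> (O0 (R \<omega>) *\<^sub>v y)) \<in> borel_measurable P"
      "(\<lambda>\<omega>. V_GS Q p dt X m c y (R \<omega>)) \<in> borel_measurable P"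
      by (intro borel_measurable_integrable integrable_simple_compose[OF sf])+
    \<comment> \<open>Positive probability of the realised assignment gives invertibility, which
      fixes the dimensions of \<open>wls_mat\<close> required by the quadratic form
      identity.\<close>
    have V_GS_eq: "V_GS Q p dt X m c y (R \<omega>) = y \<bullet> (O0 (R \<omega>) *\<^sub>v y)"
      if \<omega>: "\<omega> \<in> space P" and pos: "measure P {\<omega>' \<in> space P. R \<omega>' = R \<omega>} > 0" for \<omega>
    proof -
      have "invertible_mat (X\<^sup>T * m * R \<omega> * X)"
        unfolding R_def by (rule inv) (use pos in \<open>simp add: R_def assign_mat_eq_iff\<close>)
      moreover have "X\<^sup>T * m * R \<omega> * X \<in> carrier_mat K K" using X m R[of \<omega>] by auto
      ultimately have "inv_mat (X\<^sup>T * m * R \<omega> * X) \<in> carrier_mat K K"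
        by (intro inv_mat_carrier)
      then have W: "wls_mat X m (R \<omega>) \<in> carrier_mat K N"
        unfolding wls_mat_def using X m by (intro mult_carrier_mat) auto
      have "r \<omega> i * r \<omega> i = r \<omega> i" if "i < N" for i using r01[OF that \<omega>] by auto
      then show ?thesis
        using W unfolding O0_def Q_eq R_eq
        by (intro V_GS_eq_quadratic_form[OF _ X _ dt y]) auto
    qed
    show "AE \<omega> in P. y \<bullet> (O0 (R \<omega>) *\<^sub>v y) = V_GS Q p dt X m c y (R \<omega>)"
      by (rule AE_mp[OF AE_simple_function_fibre_pos[OF sf]]) (use V_GS_eq in \<open>auto intro!: AE_I2\<close>)
  qed
  finally show ?thesis using first by (simp add: T_def)
qed

end
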